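(* Let $n$ be an even positive integer and suppose that there exists an S-Hadamard matrix of order $n$. Then there exists a Kochen-Specker pair $(\mathcal{V},\mathcal{B})$ in $\mathbb{C}^n$ such that $|\mathcal{V}| \le \binom{n+1}{2}$ and $|\mathcal{B}| = n+1$.
   Context: The space $\mathbb{C}^n$ carries the usual inner product $\langle x,y\rangle=\sum_{i=1}^n x_i\overline{y_i}$, and orthogonality is with respect to it. For a complex matrix $H$, $H^*$ denotes its conjugate transpose, and $I_n$ is the $n\times n$ identity matrix. S-Hadamard matrix: an $n\times n$ matrix $H=(h_{i,j})$ with complex entries is called an S-Hadamard matrix of order $n$ if (1) $HH^*=nI_n$; (2) $|h_{i,j}|=1$ for all $1\le i,j\le n$; (3) for all $1\le k,\ell\le n$ with $k\ne \ell$, $\sum_{j=1}^n h_{k,j}^2\,\overline{h_{\ell,j}^2}=0$. Kochen-Specker pair: $(\mathcal{V},\mathcal{B})$ is a Kochen-Specker pair in $\mathbb{C}^n$ if (1) $\mathcal{V}$ is a finite set of vectors in $\mathbb{C}^n$; (2) $\mathcal{B}=(B_1,\ldots,B_k)$ is a list, where $k$ is odd, and for all $i=1,\ldots,k$ the set $B_i$ is an orthogonal basis of $\mathbb{C}^n$ with $B_i\subset\mathcal{V}$; (3) for each $v\in\mathcal{V}$, the number of indices $i$ such that $v\in B_i$ is even. Here $|\mathcal{V}|$ is the cardinality of the set $\mathcal{V}$ and $|\mathcal{B}|=k$ is the length of the list $\mathcal{B}$. *)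

theory Defs
  imports "Jordan_Normal_Form.Schur_Decomposition" "Jordan_Normal_Form.VS_Connect"
begin

text \<open>
  Vectors and matrices of size \<open>n\<close> are elements of \<^term>\<open>carrier_vec n\<close> and
  \<^term>\<open>carrier_mat n n\<close>; indices run over \<open>0, \<dots>, n - 1\<close>. The inner product
  \<open>v \<bullet>c w\<close> is conjugate-linear in its second argument.
\<close>

definition s_hadamard :: "nat \<Rightarrow> complex mat \<Rightarrow> bool" where
  "s_hadamard n H \<longleftrightarrow>
     H \<in> carrier_mat n n \<and>
     H * mat_adjoint H = of_nat n \<cdot>\<^sub>m 1\<^sub>m n \<and>
     (\<forall>i<n. \<forall>j<n. cmod (H $$ (i, j)) = 1) \<and>
     (\<forall>k<n. \<forall>l<n. k \<noteq> l \<longrightarrow> (\<Sum>j<n. (H $$ (k, j))\<^sup>2 * cnj ((H $$ (l, j))\<^sup>2)) = 0)"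

definition orthogonal_basis :: "nat \<Rightarrow> complex vec set \<Rightarrow> bool" where
  "orthogonal_basis n B \<longleftrightarrow>
     vectorspace.basis class_ring (module_vec TYPE(complex) n) B \<and>
     (\<forall>v\<in>B. \<forall>w\<in>B. v \<noteq> w \<longrightarrow> v \<bullet>c w = 0)"

text \<open>The second component is a list of bases, so repetitions are counted with multiplicity.\<close>

definition kochen_specker_pair :: "nat \<Rightarrow> complex vec set \<Rightarrow> complex vec set list \<Rightarrow> bool" where
  "kochen_specker_pair n V Bs \<longleftrightarrow>
     finite V \<and> V \<subseteq> carrier_vec n \<and>
     odd (length Bs) \<and>
     (\<forall>i<length Bs. orthogonal_basis n (Bs ! i) \<and> Bs ! i \<subseteq> V) \<and>
     (\<forall>v\<in>V. even (card {i. i < length Bs \<and> v \<in> Bs ! i}))"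

end

theory Submission
  imports Defs "HOL-Library.Z2" "HOL-Library.Disjoint_Sets"
begin

text \<open>
  Write \<open>h\<^sub>0, \<dots>, h\<^bsub>n-1\<^esub>\<close> for the rows of the S-Hadamard matrix and \<open>\<circ>\<close> for the entrywise
  product. Since the entries are unimodular, multiplying by \<open>h\<^sub>i\<close> entrywise is unitary, so
  \<open>B\<^sub>i = {h\<^sub>i \<circ> h\<^sub>j | j < n}\<close> is an orthogonal basis; the third S-Hadamard condition says that
  \<open>B\<^sub>n = {h\<^sub>j \<circ> h\<^sub>j | j < n}\<close> is one too. Any two of these \<open>n + 1\<close> bases share one designated
  vector: \<open>h\<^sub>i \<circ> h\<^sub>j\<close> for \<open>B\<^sub>i\<close> and \<open>B\<^sub>j\<close>, and \<open>h\<^sub>i \<circ> h\<^sub>i\<close> for \<open>B\<^sub>i\<close> and \<open>B\<^sub>n\<close>. So the vectors are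
  indexed by the edges of a complete graph on the \<open>n + 1\<close> bases, and each edge contributes
  two to the count of bases containing a given vector.
\<close>

text \<open>\<open>h\<close> splits \<open>A\<close> into pairs, and each pair contributes 1 + 1 = 0
  in \<open>bit\<close>, where the sum of ones is the parity of \<open>card A\<close>.\<close>

lemma even_card_involution:
  assumes "\<And>x. x \<in> A \<Longrightarrow> h x \<in> A" "\<And>x. x \<in> A \<Longrightarrow> h (h x) = x" "\<And>x. x \<in> A \<Longrightarrow> h x \<noteq> x"
  shows "even (card A)"
proof -
  have "(\<Sum>x\<in>A. 1 :: bit) = 0"
    by (rule sum_involution_eq_0[where h = h]) (use assms in auto)
  then have "even (of_nat (card A) :: bit)"
    by simp
  then show ?thesis
    by (simp only: even_of_nat)
qed

text \<open>
  Distinct edges \<open>{i, j}\<close> may carry the same label, but the edges at one vertex carry distinct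
  labels, so the edges labelled \<open>v\<close> form a matching.
\<close>
lemma even_card_incident_label:
  assumes sym: "\<And>i j. i \<in> I \<Longrightarrow> j \<in> I \<Longrightarrow> w i j = w j i"
    and inj: "\<And>i. i \<in> I \<Longrightarrow> inj_on (w i) (I - {i})"
  shows "even (card {i \<in> I. v \<in> w i ` (I - {i})})"
proof -
  \<comment> \<open>\<open>h i\<close> is the other end of the edge at \<open>i\<close> labelled
    \<open>v\<close>: unique by \<open>inj\<close>, and \<open>h\<close> is an involution by
    \<open>sym\<close>.\<close>
  define h where "h i = (THE j. j \<in> I - {i} \<and> w i j = v)" for i
  have h_eq: "h i = j" if "i \<in> I" "j \<in> I - {i}" "w i j = v" for i j
    unfolding h_def using that inj[OF that(1)] by (intro the_equality) (auto dest: inj_onD)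
  show ?thesis
  proof (rule even_card_involution[where h = h])
    fix i assume "i \<in> {i \<in> I. v \<in> w i ` (I - {i})}"
    then obtain j where j: "i \<in> I" "j \<in> I - {i}" "w i j = v"
      by auto
    have hi: "h i = j" and hj: "h j = i"
      using j h_eq[of i j] h_eq[of j i] sym[of i j] by auto
    show "h i \<in> {i \<in> I. v \<in> w i ` (I - {i})}"
      using j sym[of i j] by (auto simp: hi intro!: image_eqI[of _ _ i])
    show "h (h i) = i" "h i \<noteq> i"
      using j hi hj by auto
  qed
qed

text \<open>Symmetry makes a label depend only on the two-element set of ends; the linear order
  serves to recover them as \<open>Min\<close> and \<open>Max\<close>.\<close>

lemma card_edge_labels_le:
  fixes w :: "'i :: linorder \<Rightarrow> 'i \<Rightarrow> 'a"
  assumes fin: "finite I"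
    and sym: "\<And>i j. i \<in> I \<Longrightarrow> j \<in> I \<Longrightarrow> w i j = w j i"
  shows "card (\<Union>i\<in>I. w i ` (I - {i})) \<le> card I choose 2"
proof -
  let ?E = "{e. e \<subseteq> I \<and> card e = 2}"
  have "(\<Union>i\<in>I. w i ` (I - {i})) \<subseteq> (\<lambda>e. w (Min e) (Max e)) ` ?E"
  proof
    fix v assume "v \<in> (\<Union>i\<in>I. w i ` (I - {i}))"
    then obtain i j where ij: "i \<in> I" "j \<in> I" "j \<noteq> i" and v: "v = w i j"
      by blast
    have "w i j = w (Min {i, j}) (Max {i, j})"
      using ij sym[of i j] by (cases "i \<le> j") (auto simp: min_def max_def)
    then show "v \<in> (\<lambda>e. w (Min e) (Max e)) ` ?E"
      using ij by (intro image_eqI[of _ _ "{i, j}"]) (auto simp: v)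
  qed
  moreover have finE: "finite ?E"
    using fin by auto
  ultimately have "card (\<Union>i\<in>I. w i ` (I - {i})) \<le> card ?E"
    by (meson card_image_le card_mono finite_imageI order_trans)
  then show ?thesis
    using n_subsets[OF fin, of 2] by simp
qed

text \<open>Pairing a vanishing combination with \<open>u\<close> in \<open>B\<close> leaves only
  \<open>a u * (u \<bullet>c u)\<close>, whose second factor is nonzero.\<close>

lemma (in cof_vec_space) lin_indpt_pairwise_orthogonal:
  assumes fin: "finite B" and B: "B \<subseteq> carrier_vec n"
    and nz: "0\<^sub>v n \<notin> B"
    and orth: "\<And>v w. v \<in> B \<Longrightarrow> w \<in> B \<Longrightarrow> v \<noteq> w \<Longrightarrow> v \<bullet>c w = 0"
  shows "lin_indpt B"
proof (rule finite_lin_indpt2[OF fin])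
  show "B \<subseteq> carrier_vec n"
    by (rule B)
  fix a assume "lincomb a B = 0\<^sub>v n"
  then have a: "finsum V (\<lambda>v. a v \<cdot>\<^sub>v v) B = 0\<^sub>v n"
    by (simp add: lincomb_def)
  have "a u = 0" if u: "u \<in> B" for u
  proof -
    have uc: "u \<in> carrier_vec n" "conjugate u \<in> carrier_vec n"
      using u B by auto
    have "0 = finsum V (\<lambda>v. a v \<cdot>\<^sub>v v) B \<bullet>c u"
      using uc by (simp add: a)
    also have "\<dots> = (\<Sum>v\<in>B. (a v \<cdot>\<^sub>v v) \<bullet>c u)"
      using B uc by (intro finsum_scalar_prod_sum) auto
    also have "\<dots> = (\<Sum>v\<in>B. a v * (v \<bullet>c u))"
    proof (rule sum.cong)
      show "(a v \<cdot>\<^sub>v v) \<bullet>c u = a v * (v \<bullet>c u)" if "v \<in> B" for v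
        using B that uc by (intro smult_scalar_prod_distrib[of v n]) auto
    qed simp
    also have "\<dots> = (\<Sum>v\<in>B. if v = u then a u * (u \<bullet>c u) else 0)"
      using u orth by (intro sum.cong) auto
    also have "\<dots> = a u * (u \<bullet>c u)"
      using fin u by simp
    finally show ?thesis
      using nz u uc by auto
  qed
  then show "\<forall>v\<in>B. a v = 0"
    by simp
qed

lemma (in cof_vec_space) basis_pairwise_orthogonal:
  assumes "finite B" "B \<subseteq> carrier_vec n" "card B = n" "0\<^sub>v n \<notin> B"
    and "\<And>v w. v \<in> B \<Longrightarrow> w \<in> B \<Longrightarrow> v \<noteq> w \<Longrightarrow> v \<bullet>c w = 0"
  shows "basis B"
  using assms lin_indpt_pairwise_orthogonal[of B]
  by (intro dim_li_is_basis fin_dim) (simp_all add: dim_is_n)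

lemma orthogonal_basisI:
  assumes "finite B" "B \<subseteq> carrier_vec n" "card B = n" "0\<^sub>v n \<notin> B"
    and "\<And>v w. v \<in> B \<Longrightarrow> w \<in> B \<Longrightarrow> v \<noteq> w \<Longrightarrow> v \<bullet>c w = 0"
  shows "orthogonal_basis n B"
  unfolding orthogonal_basis_def
  using assms cof_vec_space.basis_pairwise_orthogonal[of B n] by blast

text \<open>The equivalence \<open>orth\<close> encodes both orthogonality
  (\<open>j \<noteq> k\<close>) and nonzero labels (\<open>j = k\<close>).\<close>

lemma kochen_specker_pair_of_edge_labels:
  fixes w :: "nat \<Rightarrow> nat \<Rightarrow> complex vec"
  assumes n: "even n"
    and carr: "\<And>i j. w i j \<in> carrier_vec n"
    and sym: "\<And>i j. w i j = w j i"
    and orth: "\<And>i j k. \<lbrakk>i \<le> n; j \<le> n; k \<le> n; j \<noteq> i; k \<noteq> i\<rbrakk> \<Longrightarrow> w i j \<bullet>c w i k = 0 \<longleftrightarrow> j \<noteq> k"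
  shows "\<exists>V Bs. kochen_specker_pair n V Bs \<and> card V \<le> (n + 1) choose 2 \<and> length Bs = n + 1"
proof -
  let ?I = "{..n}"
  define B where "B i = w i ` (?I - {i})" for i
  define Bs where "Bs = map B [0..<n + 1]"
  define V where "V = (\<Union>i\<in>?I. B i)"
  have len: "length Bs = n + 1"
    by (simp add: Bs_def)
  have nth: "Bs ! i = B i" if "i < n + 1" for i
    using that by (simp add: Bs_def del: upt_Suc)
  \<comment> \<open>Equal labels for distinct \<open>j\<close> and \<open>k\<close> would be
    orthogonal to themselves, against \<open>orth\<close> at equal indices.\<close>
  have inj: "inj_on (w i) (?I - {i})" if "i \<le> n" for i
    using orth[OF that] by (intro inj_onI) (auto, metis)
  have basis: "orthogonal_basis n (B i)" if i: "i \<le> n" for i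
  proof (rule orthogonal_basisI)
    show "card (B i) = n"
      using i by (simp add: B_def card_image[OF inj[OF i]])
    have "w i j \<noteq> 0\<^sub>v n" if "j \<le> n" "j \<noteq> i" for j
      using orth[of i j j] carr[of i j] i that by auto
    then show "0\<^sub>v n \<notin> B i"
      by (auto simp: B_def) metis
    show "v \<bullet>c u = 0" if "v \<in> B i" "u \<in> B i" "v \<noteq> u" for v u
      using that orth[OF i] by (auto simp: B_def)
  qed (use carr in \<open>auto simp: B_def\<close>)
  have "even (card {i. i < length Bs \<and> v \<in> Bs ! i})" for v
  proof -
    have "{i. i < length Bs \<and> v \<in> Bs ! i} = {i \<in> ?I. v \<in> w i ` (?I - {i})}"
      using nth len by (auto simp: B_def)
    then show ?thesis
      using even_card_incident_label[of ?I w v] sym inj by simp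
  qed
  moreover have "card V \<le> (n + 1) choose 2"
    using card_edge_labels_le[of ?I w] sym by (simp add: V_def B_def)
  moreover have "finite V" "V \<subseteq> carrier_vec n" "B i \<subseteq> V" if "i \<le> n" for i
    using carr that by (auto simp: V_def B_def)
  ultimately have "kochen_specker_pair n V Bs" "card V \<le> (n + 1) choose 2"
    using n len nth basis by (auto simp: kochen_specker_pair_def)
  then show ?thesis
    using len by blast
qed

lemma cscalar_prod_vec:
  fixes f g :: "nat \<Rightarrow> complex"
  shows "vec n f \<bullet>c vec n g = (\<Sum>m<n. f m * cnj (g m))"
  by (simp add: scalar_prod_def lessThan_atLeast0)

theorem theorem3p1:
  fixes n :: nat
  assumes "n > 0" and "even n"
    and "\<exists>H. s_hadamard n H"
  shows "\<exists>V Bs. kochen_specker_pair n V Bs \<and> card V \<le> (n + 1) choose 2 \<and> length Bs = n + 1"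
proof -
  obtain H where H: "H \<in> carrier_mat n n"
    and HH: "H * mat_adjoint H = of_nat n \<cdot>\<^sub>m 1\<^sub>m n"
    and unit: "\<And>i j. i < n \<Longrightarrow> j < n \<Longrightarrow> cmod (H $$ (i, j)) = 1"
    and sq: "\<And>k l. \<lbrakk>k < n; l < n; k \<noteq> l\<rbrakk> \<Longrightarrow>
      (\<Sum>j<n. (H $$ (k, j))\<^sup>2 * cnj ((H $$ (l, j))\<^sup>2)) = 0"
    using assms(3) unfolding s_hadamard_def by blast
  have unit': "H $$ (i, m) * cnj (H $$ (i, m)) = 1" if "i < n" "m < n" for i m
    using unit[OF that] by (simp add: complex_norm_square[symmetric])
  have rows: "(\<Sum>m<n. H $$ (k, m) * cnj (H $$ (l, m))) = (if k = l then of_nat n else 0)"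
    if "k < n" "l < n" for k l
  proof -
    have "(\<Sum>m<n. H $$ (k, m) * cnj (H $$ (l, m))) = (H * mat_adjoint H) $$ (k, l)"
      using H that
      by (auto simp: mat_adjoint_def mat_of_rows_def scalar_prod_def lessThan_atLeast0)
    then show ?thesis
      using that by (simp add: HH)
  qed
  define row where "row i j = (if j = n then i else j)" for i j :: nat
  \<comment> \<open>the edge joining \<open>B\<^sub>i\<close> and \<open>B\<^sub>n\<close> is labelled \<open>h\<^sub>i \<circ> h\<^sub>i\<close>, as if \<open>n\<close> stood for the other endpoint\<close>
  define w where "w i j = vec n (\<lambda>m. H $$ (row j i, m) * H $$ (row i j, m))" for i j
  show ?thesis
  proof (rule kochen_specker_pair_of_edge_labels[OF assms(2)])
    show "w i j \<in> carrier_vec n" "w i j = w j i" for i j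
      by (auto simp: w_def mult.commute)
    fix i j k assume ijk: "i \<le> n" "j \<le> n" "k \<le> n" "j \<noteq> i" "k \<noteq> i"
    show "w i j \<bullet>c w i k = 0 \<longleftrightarrow> j \<noteq> k"
    proof (cases "i = n")
      case True
      then have jk: "j < n" "k < n"
        using ijk by auto
      have "w i j \<bullet>c w i k = (\<Sum>m<n. (H $$ (j, m))\<^sup>2 * cnj ((H $$ (k, m))\<^sup>2))"
        using True jk by (simp add: w_def row_def cscalar_prod_vec power2_eq_square)
      moreover have "(\<Sum>m<n. (H $$ (j, m))\<^sup>2 * cnj ((H $$ (j, m))\<^sup>2)) = (\<Sum>m<n. 1)"
        using jk unit' by (intro sum.cong) (simp_all flip: power_mult_distrib)
      ultimately show ?thesis
        using sq[OF jk] assms(1) by auto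
    next
      case False
      then have lt: "i < n" "row i j < n" "row i k < n"
        using ijk by (auto simp: row_def)
      have "w i j \<bullet>c w i k = (\<Sum>m<n. H $$ (i, m) * H $$ (row i j, m) * cnj (H $$ (i, m) * H $$ (row i k, m)))"
        using False by (simp add: w_def row_def[of _ i] cscalar_prod_vec)
      \<comment> \<open>The row \<open>i\<close> common to both labels is unimodular and cancels,
        leaving a product of two rows of \<open>H\<close>.\<close>
      also have "\<dots> = (\<Sum>m<n. (H $$ (i, m) * cnj (H $$ (i, m))) * (H $$ (row i j, m) * cnj (H $$ (row i k, m))))"
        by (intro sum.cong) (auto simp: mult_ac)
      also have "\<dots> = (\<Sum>m<n. H $$ (row i j, m) * cnj (H $$ (row i k, m)))"
        using lt unit' by (intro sum.cong) auto
      also have "\<dots> = (if row i j = row i k then of_nat n else 0)"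
        using rows lt by simp
      finally have "w i j \<bullet>c w i k = 0 \<longleftrightarrow> row i j \<noteq> row i k"
        using assms(1) by auto
      \<comment> \<open>\<open>row i\<close> is injective away from \<open>i\<close>: it sends
        \<open>n\<close> to the excluded index \<open>i\<close> and fixes the rest.\<close>
      then show ?thesis
        using ijk by (auto simp: row_def split: if_splits)
    qed
  qed
qed

end
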